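(* Let $R$ be an integral domain. The following conditions are equivalent. (1) $GCl(R)$ is connected. (2) $GCl(R)$ is complete. (3) $R$ is a PID.
   Context: Let $K$ be the quotient field of $R$. $GCl(R)$ is the simple graph whose vertices are the nonzero ideals of $R$ (including $R$ itself), with an edge between two distinct nonzero ideals $I$ and $J$ if and only if there is a nonzero $k\in K$ such that $I=Jk$. *)

theory Defs
  imports
    "HOL-Algebra.Ring_Divisibility"
    "Graph_Theory.Digraph_Component"
begin

section \<open>The quotient field of an integral domain\<close>

definition frac_rel :: "('a, 'm) ring_scheme \<Rightarrow> (('a \<times> 'a) \<times> ('a \<times> 'a)) set" where
  "frac_rel R = {((a, b), (c, d)).
     a \<in> carrier R \<and> b \<in> carrier R - {\<zero>\<^bsub>R\<^esub>} \<and>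
     c \<in> carrier R \<and> d \<in> carrier R - {\<zero>\<^bsub>R\<^esub>} \<and>
     a \<otimes>\<^bsub>R\<^esub> d = c \<otimes>\<^bsub>R\<^esub> b}"

definition fraction :: "('a, 'm) ring_scheme \<Rightarrow> 'a \<Rightarrow> 'a \<Rightarrow> ('a \<times> 'a) set" where
  "fraction R a b = frac_rel R `` {(a, b)}"

definition quotient_field :: "('a, 'm) ring_scheme \<Rightarrow> ('a \<times> 'a) set ring" where
  "quotient_field R =
    \<lparr> carrier = {fraction R a b | a b. a \<in> carrier R \<and> b \<in> carrier R - {\<zero>\<^bsub>R\<^esub>}},
      mult = (\<lambda>X Y. \<Union>x\<in>X. \<Union>y\<in>Y. fraction R (fst x \<otimes>\<^bsub>R\<^esub> fst y) (snd x \<otimes>\<^bsub>R\<^esub> snd y)),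
      one = fraction R \<one>\<^bsub>R\<^esub> \<one>\<^bsub>R\<^esub>,
      zero = fraction R \<zero>\<^bsub>R\<^esub> \<one>\<^bsub>R\<^esub>,
      add = (\<lambda>X Y. \<Union>x\<in>X. \<Union>y\<in>Y.
        fraction R (fst x \<otimes>\<^bsub>R\<^esub> snd y \<oplus>\<^bsub>R\<^esub> fst y \<otimes>\<^bsub>R\<^esub> snd x) (snd x \<otimes>\<^bsub>R\<^esub> snd y)) \<rparr>"

definition frac_embed :: "('a, 'm) ring_scheme \<Rightarrow> 'a \<Rightarrow> ('a \<times> 'a) set" where
  "frac_embed R a = fraction R a \<one>\<^bsub>R\<^esub>"

context "domain"
begin

abbreviation (input) "den \<equiv> carrier R - {\<zero>}"

lemma den_mult: "b \<in> den \<Longrightarrow> d \<in> den \<Longrightarrow> b \<otimes> d \<in> den"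
  using integral by auto

lemma equiv_frac_rel: "equiv (carrier R \<times> den) (frac_rel R)"
proof (rule equivI)
  show "trans (frac_rel R)"
  proof (rule transI, clarsimp simp: frac_rel_def)
    fix a b c d e f
    assume *: "a \<in> carrier R" "b \<in> carrier R" "c \<in> carrier R" "d \<in> carrier R" "d \<noteq> \<zero>"
      "e \<in> carrier R" "f \<in> carrier R"
      and eq: "a \<otimes> d = c \<otimes> b" "c \<otimes> f = e \<otimes> d"
    have "(a \<otimes> f) \<otimes> d = (a \<otimes> d) \<otimes> f" using * by (simp add: m_ac)
    also have "\<dots> = (c \<otimes> f) \<otimes> b" unfolding eq(1) using * by (simp add: m_ac)
    also have "\<dots> = (e \<otimes> b) \<otimes> d" unfolding eq(2) using * by (simp add: m_ac)
    finally show "a \<otimes> f = e \<otimes> b" using * m_rcancel by simp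
  qed
qed (auto simp: frac_rel_def refl_on_def sym_def)

lemma frac_eq_iff:
  assumes "a \<in> carrier R" "b \<in> den" "c \<in> carrier R" "d \<in> den"
  shows "fraction R a b = fraction R c d \<longleftrightarrow> a \<otimes> d = c \<otimes> b"
  using assms eq_equiv_class_iff[OF equiv_frac_rel, of "(a, b)" "(c, d)"]
  by (auto simp: fraction_def frac_rel_def)

lemma quotient_field_mult:
  assumes "a \<in> carrier R" "b \<in> den" "c \<in> carrier R" "d \<in> den"
  shows "fraction R a b \<otimes>\<^bsub>quotient_field R\<^esub> fraction R c d = fraction R (a \<otimes> c) (b \<otimes> d)"
proof -
  have "congruent2 (frac_rel R) (frac_rel R)
     (\<lambda>x y. fraction R (fst x \<otimes> fst y) (snd x \<otimes> snd y))"
  proof (rule congruent2I', clarsimp simp: frac_rel_def)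
    fix a1 b1 a2 b2 c1 d1 c2 d2
    assume *: "a1 \<in> carrier R" "b1 \<in> carrier R" "a2 \<in> carrier R" "b2 \<in> carrier R"
      "c1 \<in> carrier R" "d1 \<in> carrier R" "c2 \<in> carrier R" "d2 \<in> carrier R"
      and nz: "b1 \<noteq> \<zero>" "b2 \<noteq> \<zero>" "d1 \<noteq> \<zero>" "d2 \<noteq> \<zero>"
      and e: "a1 \<otimes> b2 = a2 \<otimes> b1" "c1 \<otimes> d2 = c2 \<otimes> d1"
    have "(a1 \<otimes> c1) \<otimes> (b2 \<otimes> d2) = (a1 \<otimes> b2) \<otimes> (c1 \<otimes> d2)" using * by (simp add: m_ac)
    also have "\<dots> = (a2 \<otimes> c2) \<otimes> (b1 \<otimes> d1)" unfolding e using * by (simp add: m_ac)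
    finally show "fraction R (a1 \<otimes> c1) (b1 \<otimes> d1) = fraction R (a2 \<otimes> c2) (b2 \<otimes> d2)"
      using * nz den_mult by (subst frac_eq_iff) auto
  qed
  from UN_equiv_class2[OF equiv_frac_rel equiv_frac_rel this, of "(a, b)" "(c, d)"] assms
  show ?thesis by (simp add: quotient_field_def fraction_def)
qed

lemma quotient_field_add:
  assumes "a \<in> carrier R" "b \<in> den" "c \<in> carrier R" "d \<in> den"
  shows "fraction R a b \<oplus>\<^bsub>quotient_field R\<^esub> fraction R c d = fraction R (a \<otimes> d \<oplus> c \<otimes> b) (b \<otimes> d)"
proof -
  have "congruent2 (frac_rel R) (frac_rel R)
     (\<lambda>x y. fraction R (fst x \<otimes> snd y \<oplus> fst y \<otimes> snd x) (snd x \<otimes> snd y))"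
  proof (rule congruent2I', clarsimp simp: frac_rel_def)
    fix a1 b1 a2 b2 c1 d1 c2 d2
    assume *: "a1 \<in> carrier R" "b1 \<in> carrier R" "a2 \<in> carrier R" "b2 \<in> carrier R"
      "c1 \<in> carrier R" "d1 \<in> carrier R" "c2 \<in> carrier R" "d2 \<in> carrier R"
      and nz: "b1 \<noteq> \<zero>" "b2 \<noteq> \<zero>" "d1 \<noteq> \<zero>" "d2 \<noteq> \<zero>"
      and e: "a1 \<otimes> b2 = a2 \<otimes> b1" "c1 \<otimes> d2 = c2 \<otimes> d1"
    have "(a1 \<otimes> d1 \<oplus> c1 \<otimes> b1) \<otimes> (b2 \<otimes> d2)
        = (a1 \<otimes> b2) \<otimes> (d1 \<otimes> d2) \<oplus> (c1 \<otimes> d2) \<otimes> (b1 \<otimes> b2)"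
      using * by (simp add: l_distr r_distr m_ac)
    also have "\<dots> = (a2 \<otimes> d2 \<oplus> c2 \<otimes> b2) \<otimes> (b1 \<otimes> d1)"
      unfolding e using * by (simp add: l_distr r_distr m_ac)
    finally show "fraction R (a1 \<otimes> d1 \<oplus> c1 \<otimes> b1) (b1 \<otimes> d1) = fraction R (a2 \<otimes> d2 \<oplus> c2 \<otimes> b2) (b2 \<otimes> d2)"
      using * nz den_mult by (subst frac_eq_iff) auto
  qed
  from UN_equiv_class2[OF equiv_frac_rel equiv_frac_rel this, of "(a, b)" "(c, d)"] assms
  show ?thesis by (simp add: quotient_field_def fraction_def)
qed

lemma quotient_field_simps:
  "\<one>\<^bsub>quotient_field R\<^esub> = fraction R \<one> \<one>"
  "\<zero>\<^bsub>quotient_field R\<^esub> = fraction R \<zero> \<one>"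
  by (simp_all add: quotient_field_def)

lemma frac_in_carrier:
  "a \<in> carrier R \<Longrightarrow> b \<in> den \<Longrightarrow> fraction R a b \<in> carrier (quotient_field R)"
  by (auto simp: quotient_field_def)

lemma quotient_field_cases:
  assumes "x \<in> carrier (quotient_field R)"
  obtains a b where "x = fraction R a b" "a \<in> carrier R" "b \<in> den"
  using assms by (auto simp: quotient_field_def)

lemma field_quotient_field: "field (quotient_field R)"
proof -
  note S = quotient_field_mult quotient_field_add quotient_field_simps
  have one: "\<one> \<in> den" by simp
  have "abelian_group (quotient_field R)"
  proof (rule abelian_groupI)
    fix x y assume "x \<in> carrier (quotient_field R)" "y \<in> carrier (quotient_field R)"
    then obtain a b c d where xy: "x = fraction R a b" "a \<in> carrier R" "b \<in> den"
        "y = fraction R c d" "c \<in> carrier R" "d \<in> den"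
      by (metis quotient_field_cases)
    show "x \<oplus>\<^bsub>quotient_field R\<^esub> y \<in> carrier (quotient_field R)"
      unfolding xy using xy(2,3,5,6) by (subst S) (auto intro!: frac_in_carrier den_mult dest: integral)
    show "x \<oplus>\<^bsub>quotient_field R\<^esub> y = y \<oplus>\<^bsub>quotient_field R\<^esub> x"
      unfolding xy(1,4) using xy(2,3,5,6) by (simp add: S m_comm a_comm)
    fix z assume "z \<in> carrier (quotient_field R)"
    then obtain e f where z: "z = fraction R e f" "e \<in> carrier R" "f \<in> den"
      by (metis quotient_field_cases)
    have "x \<oplus>\<^bsub>quotient_field R\<^esub> y \<oplus>\<^bsub>quotient_field R\<^esub> z
        = fraction R ((a \<otimes> d \<oplus> c \<otimes> b) \<otimes> f \<oplus> e \<otimes> (b \<otimes> d)) (b \<otimes> d \<otimes> f)"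
      unfolding xy z using xy z den_mult by (simp add: S)
    moreover have "x \<oplus>\<^bsub>quotient_field R\<^esub> (y \<oplus>\<^bsub>quotient_field R\<^esub> z)
        = fraction R (a \<otimes> (d \<otimes> f) \<oplus> (c \<otimes> f \<oplus> e \<otimes> d) \<otimes> b) (b \<otimes> (d \<otimes> f))"
      unfolding xy z using xy z den_mult by (simp add: S)
    moreover have "(a \<otimes> d \<oplus> c \<otimes> b) \<otimes> f \<oplus> e \<otimes> (b \<otimes> d) = a \<otimes> (d \<otimes> f) \<oplus> (c \<otimes> f \<oplus> e \<otimes> d) \<otimes> b"
      using xy z by (simp add: l_distr r_distr m_ac a_ac)
    moreover have "b \<otimes> d \<otimes> f = b \<otimes> (d \<otimes> f)"
      using xy z by (simp add: m_ac)
    ultimately show "x \<oplus>\<^bsub>quotient_field R\<^esub> y \<oplus>\<^bsub>quotient_field R\<^esub> z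
        = x \<oplus>\<^bsub>quotient_field R\<^esub> (y \<oplus>\<^bsub>quotient_field R\<^esub> z)" by simp
  next
    show "\<zero>\<^bsub>quotient_field R\<^esub> \<in> carrier (quotient_field R)"
      by (simp add: S frac_in_carrier)
  next
    fix x assume "x \<in> carrier (quotient_field R)"
    then obtain a b where x: "x = fraction R a b" "a \<in> carrier R" "b \<in> den"
      by (metis quotient_field_cases)
    then show "\<zero>\<^bsub>quotient_field R\<^esub> \<oplus>\<^bsub>quotient_field R\<^esub> x = x"
      by (simp add: S)
    have "fraction R (\<ominus> a) b \<oplus>\<^bsub>quotient_field R\<^esub> x = fraction R (\<ominus> a \<otimes> b \<oplus> a \<otimes> b) (b \<otimes> b)"
      using x by (simp add: S)
    also have "\<dots> = \<zero>\<^bsub>quotient_field R\<^esub>"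
      unfolding S using x den_mult by (subst frac_eq_iff) (auto simp: l_minus l_neg)
    finally show "\<exists>y\<in>carrier (quotient_field R). y \<oplus>\<^bsub>quotient_field R\<^esub> x = \<zero>\<^bsub>quotient_field R\<^esub>"
      using x frac_in_carrier[of "\<ominus> a" b] by auto
  qed
  moreover have "comm_monoid (quotient_field R)"
  proof (rule comm_monoidI)
    fix x y assume "x \<in> carrier (quotient_field R)" "y \<in> carrier (quotient_field R)"
    then obtain a b c d where xy: "x = fraction R a b" "a \<in> carrier R" "b \<in> den"
        "y = fraction R c d" "c \<in> carrier R" "d \<in> den"
      by (metis quotient_field_cases)
    show "x \<otimes>\<^bsub>quotient_field R\<^esub> y \<in> carrier (quotient_field R)"
      unfolding xy using xy(2,3,5,6) by (subst S) (auto intro!: frac_in_carrier den_mult dest: integral)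
    show "x \<otimes>\<^bsub>quotient_field R\<^esub> y = y \<otimes>\<^bsub>quotient_field R\<^esub> x"
      unfolding xy(1,4) using xy(2,3,5,6) by (simp add: S m_comm)
    fix z assume "z \<in> carrier (quotient_field R)"
    then obtain e f where z: "z = fraction R e f" "e \<in> carrier R" "f \<in> den"
      by (metis quotient_field_cases)
    show "x \<otimes>\<^bsub>quotient_field R\<^esub> y \<otimes>\<^bsub>quotient_field R\<^esub> z
        = x \<otimes>\<^bsub>quotient_field R\<^esub> (y \<otimes>\<^bsub>quotient_field R\<^esub> z)"
      unfolding xy z using xy z den_mult by (simp add: S m_assoc)
  next
    show "\<one>\<^bsub>quotient_field R\<^esub> \<in> carrier (quotient_field R)"
      by (simp add: S frac_in_carrier)
  next
    fix x assume "x \<in> carrier (quotient_field R)"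
    then obtain a b where "x = fraction R a b" "a \<in> carrier R" "b \<in> den"
      by (metis quotient_field_cases)
    then show "\<one>\<^bsub>quotient_field R\<^esub> \<otimes>\<^bsub>quotient_field R\<^esub> x = x"
      by (simp add: S)
  qed
  moreover have "(x \<oplus>\<^bsub>quotient_field R\<^esub> y) \<otimes>\<^bsub>quotient_field R\<^esub> z
      = x \<otimes>\<^bsub>quotient_field R\<^esub> z \<oplus>\<^bsub>quotient_field R\<^esub> y \<otimes>\<^bsub>quotient_field R\<^esub> z"
    if "x \<in> carrier (quotient_field R)" "y \<in> carrier (quotient_field R)"
      "z \<in> carrier (quotient_field R)" for x y z
  proof -
    from that obtain a b c d e f where xyz: "x = fraction R a b" "a \<in> carrier R" "b \<in> den"
        "y = fraction R c d" "c \<in> carrier R" "d \<in> den" "z = fraction R e f" "e \<in> carrier R" "f \<in> den"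
      by (metis quotient_field_cases)
    have l: "(x \<oplus>\<^bsub>quotient_field R\<^esub> y) \<otimes>\<^bsub>quotient_field R\<^esub> z
        = fraction R ((a \<otimes> d \<oplus> c \<otimes> b) \<otimes> e) (b \<otimes> d \<otimes> f)"
      unfolding xyz using xyz den_mult by (simp add: S)
    have r: "x \<otimes>\<^bsub>quotient_field R\<^esub> z \<oplus>\<^bsub>quotient_field R\<^esub> y \<otimes>\<^bsub>quotient_field R\<^esub> z
        = fraction R (a \<otimes> e \<otimes> (d \<otimes> f) \<oplus> c \<otimes> e \<otimes> (b \<otimes> f)) (b \<otimes> f \<otimes> (d \<otimes> f))"
      unfolding xyz using xyz den_mult by (simp add: S)
    show ?thesis
      unfolding l r
    proof (subst frac_eq_iff)
      show "(a \<otimes> d \<oplus> c \<otimes> b) \<otimes> e \<otimes> (b \<otimes> f \<otimes> (d \<otimes> f))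
          = (a \<otimes> e \<otimes> (d \<otimes> f) \<oplus> c \<otimes> e \<otimes> (b \<otimes> f)) \<otimes> (b \<otimes> d \<otimes> f)"
        using xyz by (simp add: l_distr r_distr m_ac)
    qed (use xyz den_mult in auto)
  qed
  ultimately have "cring (quotient_field R)"
    by (rule cringI)
  then interpret K: cring "quotient_field R" .
  show ?thesis
  proof (rule K.cring_fieldI2)
    show "\<zero>\<^bsub>quotient_field R\<^esub> \<noteq> \<one>\<^bsub>quotient_field R\<^esub>"
      unfolding S by (subst frac_eq_iff) auto
  next
    fix x assume "x \<in> carrier (quotient_field R)" and nz: "x \<noteq> \<zero>\<^bsub>quotient_field R\<^esub>"
    then obtain a b where x: "x = fraction R a b" "a \<in> carrier R" "b \<in> den"
      by (metis quotient_field_cases)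
    from nz x have a: "a \<in> den" by (auto simp: S frac_eq_iff)
    have "x \<otimes>\<^bsub>quotient_field R\<^esub> fraction R b a = fraction R (a \<otimes> b) (b \<otimes> a)"
      using x a by (simp add: S)
    also have "\<dots> = \<one>\<^bsub>quotient_field R\<^esub>"
      unfolding S using x a den_mult by (subst frac_eq_iff) (auto simp: m_comm)
    finally show "\<exists>y\<in>carrier (quotient_field R). x \<otimes>\<^bsub>quotient_field R\<^esub> y = \<one>\<^bsub>quotient_field R\<^esub>"
      using x a frac_in_carrier[of b a] by auto
  qed
qed

lemma frac_embed_hom: "frac_embed R \<in> ring_hom R (quotient_field R)"
  by (rule ring_hom_memI)
    (auto simp: frac_embed_def quotient_field_simps quotient_field_mult quotient_field_add
      frac_in_carrier)

lemma inj_on_frac_embed: "inj_on (frac_embed R) (carrier R)"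
  by (rule inj_onI) (simp add: frac_embed_def frac_eq_iff)

lemma frac_eq_divide:
  assumes "a \<in> carrier R" "b \<in> den"
  shows "fraction R a b = frac_embed R a \<otimes>\<^bsub>quotient_field R\<^esub> inv\<^bsub>quotient_field R\<^esub> frac_embed R b"
proof -
  interpret K: field "quotient_field R" by (rule field_quotient_field)
  have "fraction R \<one> b \<otimes>\<^bsub>quotient_field R\<^esub> frac_embed R b = \<one>\<^bsub>quotient_field R\<^esub>"
    unfolding frac_embed_def using assms
    by (simp add: quotient_field_mult quotient_field_simps frac_eq_iff)
  then have "inv\<^bsub>quotient_field R\<^esub> frac_embed R b = fraction R \<one> b"
    using assms frac_in_carrier[of \<one> b] frac_in_carrier[of b \<one>]
    by (intro K.comm_inv_char) (auto simp: frac_embed_def K.m_comm)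
  then show ?thesis
    using assms by (simp add: frac_embed_def quotient_field_mult)
qed

end


section \<open>The graph\<close>

text \<open>
  The equation \<open>I = Jk\<close> is between subsets of the quotient field, so both ideals are mapped
  there by the canonical embedding. The undirected edge \<open>{I, J}\<close> is represented by the two arcs
  \<open>(I, J)\<close> and \<open>(J, I)\<close>; \<open>bidirected_GCl\<close> below shows that the arc relation is indeed
  symmetric and loop-free.
\<close>

definition GCl :: "('a, 'm) ring_scheme \<Rightarrow> 'a set pair_pre_digraph" where
  "GCl R =
    \<lparr> pverts = {I. ideal I R \<and> I \<noteq> {\<zero>\<^bsub>R\<^esub>}},
      parcs = {(I, J). ideal I R \<and> I \<noteq> {\<zero>\<^bsub>R\<^esub>} \<and> ideal J R \<and> J \<noteq> {\<zero>\<^bsub>R\<^esub>} \<and> I \<noteq> J \<and>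
        (\<exists>k \<in> carrier (quotient_field R) - {\<zero>\<^bsub>quotient_field R\<^esub>}.
           frac_embed R ` I = (frac_embed R ` J) #>\<^bsub>quotient_field R\<^esub> k)} \<rparr>"

lemma (in "domain") bidirected_GCl: "pair_bidirected_digraph (GCl R)"
proof -
  interpret K: field "quotient_field R" by (rule field_quotient_field)
  let ?K = "quotient_field R"
  have inverse: "\<exists>l\<in>carrier ?K - {\<zero>\<^bsub>?K\<^esub>}. frac_embed R ` J = (frac_embed R ` I) #>\<^bsub>?K\<^esub> l"
    if I: "ideal I R" and J: "ideal J R" and k: "k \<in> carrier ?K - {\<zero>\<^bsub>?K\<^esub>}"
      and eq: "frac_embed R ` I = (frac_embed R ` J) #>\<^bsub>?K\<^esub> k" for I J k
  proof -
    have kU: "k \<in> Units ?K" using k K.field_Units by simp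
    have sub: "x \<in> carrier ?K" if "x \<in> frac_embed R ` J" for x
      using that ideal.Icarr[OF J] frac_embed_hom by (auto simp: ring_hom_def)
    have cancel: "x \<otimes>\<^bsub>?K\<^esub> k \<otimes>\<^bsub>?K\<^esub> inv\<^bsub>?K\<^esub> k = x"
      if "x \<in> frac_embed R ` J" for x
      using sub[OF that] k kU by (simp add: K.m_assoc)
    have "frac_embed R ` J = (frac_embed R ` I) #>\<^bsub>?K\<^esub> inv\<^bsub>?K\<^esub> k"
      unfolding eq r_coset_def by (auto simp: cancel[OF imageI])
    then show ?thesis
      using kU K.field_Units K.Units_inv_Units by (intro bexI[of _ "inv\<^bsub>?K\<^esub> k"]) auto
  qed
  have "(J, I) \<in> parcs (GCl R)" if arc: "(I, J) \<in> parcs (GCl R)" for I J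
  proof -
    from arc obtain k where IJ: "ideal I R" "I \<noteq> {\<zero>}" "ideal J R" "J \<noteq> {\<zero>}" "I \<noteq> J"
      and k: "k \<in> carrier ?K - {\<zero>\<^bsub>?K\<^esub>}" "frac_embed R ` I = (frac_embed R ` J) #>\<^bsub>?K\<^esub> k"
      unfolding GCl_def pair_pre_digraph.simps mem_Collect_eq prod.case by blast
    show ?thesis
      unfolding GCl_def pair_pre_digraph.simps mem_Collect_eq prod.case
      using IJ inverse[OF IJ(1,3) k] by blast
  qed
  then have "symmetric (with_proj (GCl R))"
    unfolding symmetric_def with_proj_simps by (blast intro: symI)
  then show ?thesis
    by unfold_locales (auto simp: GCl_def)
qed

text \<open>
  The library's \<open>complete_digraph\<close> is about finite graphs; this is the same condition on the arcs
  without finiteness.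
\<close>

definition complete_graph :: "('a, 'b) pre_digraph \<Rightarrow> bool" where
  "complete_graph G \<longleftrightarrow> arcs_ends G = {(u, v). (u, v) \<in> verts G \<times> verts G \<and> u \<noteq> v}"

end

theory Submission
  imports Defs
begin

text \<open>
  Multiplication by a nonzero \<open>k\<close> of the quotient field carries generators of an ideal to generators
  of its image, so being principal is inherited along the edges of the graph
  (\<open>principal_if_arc\<close>). The vertex \<open>R\<close> is principal, hence in a connected graph every nonzero ideal
  is. Conversely, any two nonzero principal ideals satisfy \<open>Rx = (Ry)(x/y)\<close>
  (\<open>principal_ideals_similar\<close>), so over a principal ideal domain all pairs of distinct vertices are
  joined. A complete graph with at least one vertex is connected, which closes the circle.
\<close>

context "domain"
begin

lemma parcs_GCl_iff:
  "(I, J) \<in> parcs (GCl R) \<longleftrightarrow>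
     ideal I R \<and> I \<noteq> {\<zero>} \<and> ideal J R \<and> J \<noteq> {\<zero>} \<and> I \<noteq> J \<and>
     (\<exists>k \<in> carrier (quotient_field R) - {\<zero>\<^bsub>quotient_field R\<^esub>}.
        frac_embed R ` I = (frac_embed R ` J) #>\<^bsub>quotient_field R\<^esub> k)"
  by (simp add: GCl_def)

lemma pverts_GCl_iff: "I \<in> pverts (GCl R) \<longleftrightarrow> ideal I R \<and> I \<noteq> {\<zero>}"
  by (simp add: GCl_def)

lemma carrier_in_pverts_GCl: "carrier R \<in> pverts (GCl R)"
  using oneideal one_not_zero one_closed unfolding pverts_GCl_iff by blast

lemma cgenideal_zero: "PIdl \<zero> = {\<zero>}"
  unfolding cgenideal_def using zero_closed by force

lemma cgenideal_one: "PIdl \<one> = carrier R"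
  unfolding cgenideal_def by (auto, metis r_one)

text \<open>
  If \<open>J = Ry\<close>, then \<open>yk\<close> lies in the image of \<open>I = Jk\<close> and so comes from some \<open>x \<in> I\<close>; as the
  embedding is an injective homomorphism, \<open>I = (Ry)k = R(yk)\<close> reads \<open>I = Rx\<close>.
\<close>

lemma principal_if_arc:
  assumes arc: "(I, J) \<in> parcs (GCl R)"
    and y: "y \<in> carrier R" and J: "J = PIdl y"
  shows "\<exists>x\<in>carrier R. I = PIdl x"
proof -
  let ?K = "quotient_field R"
  interpret K: field ?K by (rule field_quotient_field)
  from arc obtain k where I: "ideal I R" and k: "k \<in> carrier ?K"
    and eq: "frac_embed R ` I = (frac_embed R ` J) #>\<^bsub>?K\<^esub> k"
    by (auto simp: parcs_GCl_iff)
  note hom = frac_embed_hom[THEN ring_hom_closed] frac_embed_hom[THEN ring_hom_mult]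
  have "frac_embed R y \<otimes>\<^bsub>?K\<^esub> k \<in> frac_embed R ` I"
    unfolding eq r_coset_def using cgenideal_self[OF y] J by blast
  then obtain x where x: "x \<in> I" and xy: "frac_embed R x = frac_embed R y \<otimes>\<^bsub>?K\<^esub> k"
    by auto
  have xR: "x \<in> carrier R" using ideal.Icarr[OF I x] .
  have scale: "frac_embed R (r \<otimes> y) \<otimes>\<^bsub>?K\<^esub> k = frac_embed R (r \<otimes> x)" if "r \<in> carrier R" for r
    using that y xR k by (simp add: hom xy K.m_assoc)
  have "frac_embed R ` I = frac_embed R ` (PIdl x)"
    unfolding eq J r_coset_def cgenideal_def using scale by (fastforce simp: image_iff)
  then have "I = PIdl x"
    using inj_on_image_eq_iff[OF inj_on_frac_embed] ideal.Icarr[OF I]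
      ideal.Icarr[OF cgenideal_ideal[OF xR]] by (metis subsetI)
  then show ?thesis using xR by blast
qed

lemma principal_ideals_similar:
  assumes x: "x \<in> den" and y: "y \<in> den"
  shows "frac_embed R ` (PIdl x) =
    (frac_embed R ` (PIdl y)) #>\<^bsub>quotient_field R\<^esub> fraction R x y"
proof -
  have "frac_embed R (r \<otimes> y) \<otimes>\<^bsub>quotient_field R\<^esub> fraction R x y = frac_embed R (r \<otimes> x)"
    if "r \<in> carrier R" for r
    using that x y by (simp add: frac_embed_def quotient_field_mult frac_eq_iff m_ac)
  then show ?thesis
    unfolding r_coset_def cgenideal_def by (fastforce simp: image_iff)
qed

text \<open>
  Connectedness is defined through the symmetrised graph; because arcs already come in opposite
  pairs, a path there is a path of arcs ending at \<open>R = R1\<close>, and principality travels back along it.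
\<close>

lemma connected_GCl_imp_principal:
  assumes "Digraph_Component.connected (with_proj (GCl R))"
  shows "principal_domain R"
proof unfold_locales
  interpret G: pair_bidirected_digraph "GCl R" by (rule bidirected_GCl)
  fix I assume I: "ideal I R"
  show "\<exists>a\<in>carrier R. I = PIdl a"
  proof (cases "I = {\<zero>}")
    case True
    then show ?thesis using cgenideal_zero by blast
  next
    case False
    with I assms have "I \<rightarrow>\<^sup>*\<^bsub>with_proj (mk_symmetric (with_proj (GCl R)))\<^esub> carrier R"
      using carrier_in_pverts_GCl
      by (auto simp: connected_def strongly_connected_def pverts_GCl_iff)
    then have "I \<rightarrow>\<^sup>*\<^bsub>with_proj (GCl R)\<^esub> carrier R"
      by (simp add: G.reachable_mk_symmetric_eq[OF G.sym_arcs])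
    then show ?thesis
    proof (induction rule: G.converse_reachable_induct)
      case base
      show ?case using cgenideal_one by blast
    next
      case (step I J)
      then show ?case using principal_if_arc by auto
    qed
  qed
qed

lemma principal_imp_complete_GCl:
  assumes "principal_domain R"
  shows "complete_graph (with_proj (GCl R))"
proof -
  have all: "(I, J) \<in> parcs (GCl R)"
    if I: "ideal I R" "I \<noteq> {\<zero>}" and J: "ideal J R" "J \<noteq> {\<zero>}" and "I \<noteq> J" for I J
  proof -
    obtain x y where x: "x \<in> carrier R" "I = PIdl x" and y: "y \<in> carrier R" "J = PIdl y"
      using principal_domain.exists_gen[OF assms] I(1) J(1) by metis
    have xy: "x \<in> den" "y \<in> den"
      using x y I(2) J(2) cgenideal_zero by auto
    then have "fraction R x y \<in> carrier (quotient_field R) - {\<zero>\<^bsub>quotient_field R\<^esub>}"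
      by (auto simp: quotient_field_simps frac_eq_iff frac_in_carrier)
    then show ?thesis
      using that principal_ideals_similar[OF xy] unfolding parcs_GCl_iff x(2) y(2) by blast
  qed
  have "(I, J) \<in> parcs (GCl R) \<longleftrightarrow> I \<in> pverts (GCl R) \<and> J \<in> pverts (GCl R) \<and> I \<noteq> J" for I J
  proof
    assume "(I, J) \<in> parcs (GCl R)"
    then show "I \<in> pverts (GCl R) \<and> J \<in> pverts (GCl R) \<and> I \<noteq> J"
      by (simp add: parcs_GCl_iff pverts_GCl_iff)
  qed (simp add: all pverts_GCl_iff)
  then show ?thesis
    by (simp add: complete_graph_def set_eq_iff)
qed

lemma complete_GCl_imp_connected:
  assumes "complete_graph (with_proj (GCl R))"
  shows "Digraph_Component.connected (with_proj (GCl R))"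
proof -
  interpret G: pair_bidirected_digraph "GCl R" by (rule bidirected_GCl)
  have "I \<rightarrow>\<^sup>*\<^bsub>with_proj (GCl R)\<^esub> J"
    if "I \<in> pverts (GCl R)" "J \<in> pverts (GCl R)" for I J
    using that assms by (cases "I = J") (auto simp: complete_graph_def intro: G.reachable_adjI)
  then show ?thesis
    using carrier_in_pverts_GCl
    by (auto simp: connected_def strongly_connected_def G.reachable_mk_symmetric_eq[OF G.sym_arcs])
qed

end

theorem theorem4p1:
  fixes R :: "('a, 'm) ring_scheme"
  assumes "domain R"
  shows "(Digraph_Component.connected (with_proj (GCl R)) \<longleftrightarrow> complete_graph (with_proj (GCl R)))
       \<and> (complete_graph (with_proj (GCl R)) \<longleftrightarrow> principal_domain R)"
  using domain.connected_GCl_imp_principal[OF assms] domain.principal_imp_complete_GCl[OF assms]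
    domain.complete_GCl_imp_connected[OF assms] by blast

end
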